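(* For $r\in\{0,2\}$ and all $n\ge1$, and for $r\in\{6,8\}$ and all $n\ge0$, the polynomials $A_{n,r}(X)$ and $B_{n,r}(X)$ are given by \[ A_{n,r}(X) = \sum_{i=0}^{d_{A}} 12^{3i} \phi_{i}(A_{n,r}) X^{d_{A} -i}, \qquad B_{n,r}(X) = \sum_{i=0}^{d_{B}} 12^{3i} \phi_{i}(B_{n,r}) X^{d_{B} -i}, \] where \[ \phi_{i}(A_{n,r}) = \sum_{k=0}^{i} (-1)^{k} \binom{ -\tfrac{1}{12}}{i-k} \binom{ -\tfrac{5}{12}}{i-k} \binom{\kappa_{1}(A_{n,r})}{k} \binom{\kappa_{2}(A_{n,r})}{k} \binom{\kappa_{3}(A_{n,r})}{k}^{-1}, \] \[ \phi_{i}(B_{n,r}) = \sum_{k=0}^{i} (-1)^{k} \binom{ \tfrac{1}{12}}{i-k} \binom{ -\tfrac{7}{12}}{i-k} \binom{\kappa_{1}(B_{n,r})}{k} \binom{\kappa_{2}(B_{n,r})}{k} \binom{\kappa_{3}(B_{n,r})}{k}^{-1}, \] and the degrees $d_A$ (of $A_{n,r}$), $d_B$ (of $B_{n,r}$) and parameters are: for $r=0$: $d_A=n-1$, $(\kappa_1,\kappa_2,\kappa_3)(A_{n,0})=(n-\tfrac{11}{12},\,n-\tfrac{7}{12},\,2n-1)$, $d_B=n$, $(\kappa_1,\kappa_2,\kappa_3)(B_{n,0})=(n-\tfrac{1}{12},\,n-\tfrac{5}{12},\,2n-1)$; for $r=2$: $d_A=n$, $(\kappa_i)(A_{n,2})=(n+\tfrac{1}{12},\,n-\tfrac{7}{12},\,2n-1)$,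 $d_B=n-1$, $(\kappa_i)(B_{n,2})=(n-\tfrac{13}{12},\,n-\tfrac{5}{12},\,2n-1)$; for $r=6$: $d_A=n$, $(\kappa_i)(A_{n,6})=(n+\tfrac{1}{12},\,n+\tfrac{5}{12},\,2n)$, $d_B=n$, $(\kappa_i)(B_{n,6})=(n-\tfrac{1}{12},\,n-\tfrac{5}{12},\,2n)$; for $r=8$: $d_A=n$, $(\kappa_i)(A_{n,8})=(n+\tfrac{1}{12},\,n-\tfrac{7}{12},\,2n)$, $d_B=n$, $(\kappa_i)(B_{n,8})=(n-\tfrac{1}{12},\,n+\tfrac{7}{12},\,2n)$. (Equivalently $d_A=\dim S_{12n+r-2}$ and $d_B=\dim S_{12n+r}$, dimensions of spaces of cusp forms on $SL_2(\mathbb{Z})$.)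
   Context: Binomial coefficients with non-integer upper entry are $\binom{x}{k}=x(x-1)\cdots(x-k+1)/k!$. Define rational functions $a_0(x)=\frac{24(144x^2-41)}{(2x+1)(2x-1)}$, $b_0(x)=\frac{36(12x-11)(12x-7)(12x-5)(12x-1)}{x(x-1)(2x-1)^2}$, $a_2(x)=\frac{24(144x^2-29)}{(2x+1)(2x-1)}$, $b_2(x)=\frac{36(12x-13)(12x-7)(12x-5)(12x+1)}{x(x-1)(2x-1)^2}$, and set $a_{n,0}=a_0(n)$, $b_{n,0}=b_0(n)$, $a_{n,2}=a_2(n)$, $b_{n,2}=b_2(n)$, $a_{n,6}=a_0(n+\tfrac12)$, $b_{n,6}=b_0(n+\tfrac12)$, $a_{n,8}=a_2(n+\tfrac12)$, $b_{n,8}=b_2(n+\tfrac12)$. For $r\in\{0,2,6,8\}$ and $W\in\{A,B\}$ the polynomials $W_{n,r}(X)\in\mathbb{Q}[X]$ ($n\ge0$) (the Atkin-like polynomials $A_{n,r}$ of Kaneko–Koike and their adjoint polynomials $B_{n,r}$) are determined by the recursion $W_{n+1,r}(X)=(X-a_{n,r})W_{n,r}(X)-b_{n,r}W_{n-1,r}(X)$, valid for $n\ge2$ when $r\in\{0,2\}$ and for $n\ge1$ when $r\in\{6,8\}$, with initial values: $A_{0,0}=0$, $A_{1,0}=1$, $A_{2,0}=X-824$; $A_{0,2}=1$, $A_{1,2}=X-720$, $A_{2,2}=X^2-1640X+269280$; $A_{0,6}=1$, $A_{1,6}=X-1266$; $A_{0,8}=1$, $A_{1,8}=X-330$; $B_{0,0}=1$,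 $B_{1,0}=X-1008$, $B_{2,0}=X^2-1832X+497952$; $B_{0,2}=0$, $B_{1,2}=1$, $B_{2,2}=X-920$; $B_{0,6}=1$, $B_{1,6}=X-546$; $B_{0,8}=1$, $B_{1,8}=X-1338$. ($A_{n,2}$ is Atkin's orthogonal polynomial.) *)

theory Defs
  imports "HOL-Computational_Algebra.Computational_Algebra"
begin

definition a0 :: "rat \<Rightarrow> rat" where
  "a0 x = 24 * (144 * x^2 - 41) / ((2*x + 1) * (2*x - 1))"

definition b0 :: "rat \<Rightarrow> rat" where
  "b0 x = 36 * (12*x - 11) * (12*x - 7) * (12*x - 5) * (12*x - 1) / (x * (x - 1) * (2*x - 1)^2)"

definition a2 :: "rat \<Rightarrow> rat" where
  "a2 x = 24 * (144 * x^2 - 29) / ((2*x + 1) * (2*x - 1))"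

definition b2 :: "rat \<Rightarrow> rat" where
  "b2 x = 36 * (12*x - 13) * (12*x - 7) * (12*x - 5) * (12*x + 1) / (x * (x - 1) * (2*x - 1)^2)"

(* Throughout, the index r is meant to range over {0, 2, 6, 8} only; functions of r are
   left undefined for other values. The coefficients below are used only for n >= 2 (r = 0, 2)
   and n >= 1 (r = 6, 8), where none of the denominators vanishes. *)

definition coeff_a :: "nat \<Rightarrow> nat \<Rightarrow> rat" where
  "coeff_a n r =
    (if r = 0 then a0 (of_nat n)
     else if r = 2 then a2 (of_nat n)
     else if r = 6 then a0 (of_nat n + 1/2)
     else if r = 8 then a2 (of_nat n + 1/2)
     else undefined)"

definition coeff_b :: "nat \<Rightarrow> nat \<Rightarrow> rat" where
  "coeff_b n r =
    (if r = 0 then b0 (of_nat n)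
     else if r = 2 then b2 (of_nat n)
     else if r = 6 then b0 (of_nat n + 1/2)
     else if r = 8 then b2 (of_nat n + 1/2)
     else undefined)"

(* Solutions of W(n+1) = (X - a(n,r)) W(n) - b(n,r) W(n-1): the first with the recursion valid
   for n >= 1 and initial values W(0), W(1), the second with the recursion valid for n >= 2 and
   initial values W(0), W(1), W(2). *)

fun rec_from_1 :: "nat \<Rightarrow> rat poly \<Rightarrow> rat poly \<Rightarrow> nat \<Rightarrow> rat poly" where
  "rec_from_1 r w0 w1 0 = w0"
| "rec_from_1 r w0 w1 (Suc 0) = w1"
| "rec_from_1 r w0 w1 (Suc (Suc n)) =
     [:- coeff_a (Suc n) r, 1:] * rec_from_1 r w0 w1 (Suc n)
     - smult (coeff_b (Suc n) r) (rec_from_1 r w0 w1 n)"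

fun rec_from_2 :: "nat \<Rightarrow> rat poly \<Rightarrow> rat poly \<Rightarrow> rat poly \<Rightarrow> nat \<Rightarrow> rat poly" where
  "rec_from_2 r w0 w1 w2 0 = w0"
| "rec_from_2 r w0 w1 w2 (Suc 0) = w1"
| "rec_from_2 r w0 w1 w2 (Suc (Suc 0)) = w2"
| "rec_from_2 r w0 w1 w2 (Suc (Suc (Suc n))) =
     [:- coeff_a (Suc (Suc n)) r, 1:] * rec_from_2 r w0 w1 w2 (Suc (Suc n))
     - smult (coeff_b (Suc (Suc n)) r) (rec_from_2 r w0 w1 w2 (Suc n))"

(* The Atkin-like polynomials of Kaneko and Koike; r = 2 gives Atkin's orthogonal polynomials. *)
definition atkin_A :: "nat \<Rightarrow> nat \<Rightarrow> rat poly" where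
  "atkin_A n r =
    (if r = 0 then rec_from_2 0 0 1 [:-824, 1:] n
     else if r = 2 then rec_from_2 2 1 [:-720, 1:] [:269280, -1640, 1:] n
     else if r = 6 then rec_from_1 6 1 [:-1266, 1:] n
     else if r = 8 then rec_from_1 8 1 [:-330, 1:] n
     else undefined)"

(* The adjoint polynomials. *)
definition atkin_B :: "nat \<Rightarrow> nat \<Rightarrow> rat poly" where
  "atkin_B n r =
    (if r = 0 then rec_from_2 0 1 [:-1008, 1:] [:497952, -1832, 1:] n
     else if r = 2 then rec_from_2 2 0 1 [:-920, 1:] n
     else if r = 6 then rec_from_1 6 1 [:-546, 1:] n
     else if r = 8 then rec_from_1 8 1 [:-1338, 1:] n
     else undefined)"

(* d_A and d_B; the truncated subtraction is harmless since n >= 1 when r = 0 or r = 2. *)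
definition deg_A :: "nat \<Rightarrow> nat \<Rightarrow> nat" where
  "deg_A n r = (if r = 0 then n - 1 else if r \<in> {2, 6, 8} then n else undefined)"

definition deg_B :: "nat \<Rightarrow> nat \<Rightarrow> nat" where
  "deg_B n r = (if r = 2 then n - 1 else if r \<in> {0, 6, 8} then n else undefined)"

definition kappa_A :: "nat \<Rightarrow> nat \<Rightarrow> rat \<times> rat \<times> rat" where
  "kappa_A n r =
    (let x = of_nat n in
     if r = 0 then (x - 11/12, x - 7/12, 2*x - 1)
     else if r = 2 then (x + 1/12, x - 7/12, 2*x - 1)
     else if r = 6 then (x + 1/12, x + 5/12, 2*x)
     else if r = 8 then (x + 1/12, x - 7/12, 2*x)
     else undefined)"

definition kappa_B :: "nat \<Rightarrow> nat \<Rightarrow> rat \<times> rat \<times> rat" where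
  "kappa_B n r =
    (let x = of_nat n in
     if r = 0 then (x - 1/12, x - 5/12, 2*x - 1)
     else if r = 2 then (x - 13/12, x - 5/12, 2*x - 1)
     else if r = 6 then (x - 1/12, x - 5/12, 2*x)
     else if r = 8 then (x - 1/12, x + 7/12, 2*x)
     else undefined)"

definition phi_A :: "nat \<Rightarrow> nat \<Rightarrow> nat \<Rightarrow> rat" where
  "phi_A i n r =
    (case kappa_A n r of (\<kappa>1, \<kappa>2, \<kappa>3) \<Rightarrow>
      \<Sum>k=0..i. (-1)^k * ((-1/12) gchoose (i - k)) * ((-5/12) gchoose (i - k))
               * (\<kappa>1 gchoose k) * (\<kappa>2 gchoose k) * inverse (\<kappa>3 gchoose k))"

definition phi_B :: "nat \<Rightarrow> nat \<Rightarrow> nat \<Rightarrow> rat" where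
  "phi_B i n r =
    (case kappa_B n r of (\<kappa>1, \<kappa>2, \<kappa>3) \<Rightarrow>
      \<Sum>k=0..i. (-1)^k * ((1/12) gchoose (i - k)) * ((-7/12) gchoose (i - k))
               * (\<kappa>1 gchoose k) * (\<kappa>2 gchoose k) * inverse (\<kappa>3 gchoose k))"

end

theory Submission
  imports Defs
begin

text \<open>Up to the substitution \<open>t = 1728 / X\<close>, the numbers \<open>\<phi>\<^sub>i\<close> are the coefficients of a product
  \<open>F(t) G\<^sub>n(t)\<close> of two Gauss series, where \<open>F\<close> does not depend on \<open>n\<close> and \<open>G\<^sub>n\<close> has parameters
  \<open>-\<kappa>\<^sub>1, -\<kappa>\<^sub>2; -\<kappa>\<^sub>3\<close>. Passing from \<open>n\<close> to \<open>n + 1\<close> shifts \<open>(\<kappa>\<^sub>1, \<kappa>\<^sub>2, \<kappa>\<^sub>3)\<close> by \<open>(1, 1, 2)\<close>, so Gauss's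
  contiguous relation gives a three-term recursion for \<open>G\<^sub>n\<close>, and hence for \<open>F G\<^sub>n\<close>; its coefficients
  are exactly \<open>a\<^bsub>n,r\<^esub>\<close> and \<open>b\<^bsub>n,r\<^esub>\<close>. The recursion survives truncation at degree \<open>d\<close> because
  \<open>\<phi>\<^bsub>d+1\<^esub> = 0\<close>: in this coefficient the non-integral binomials telescope, and what remains is a
  Vandermonde convolution.\<close>

section \<open>Gauss series coefficients, their convolution, and binomial identities\<close>

text \<open>The coefficient of \<open>t^k\<close> in the Gauss series 2F1(-p, -q; -s; t), written
  with binomials. Where \<open>s gchoose k\<close> is 0, \<open>inverse\<close> makes the value
  0.\<close>

definition hyp_coeff :: "'a::field_char_0 \<Rightarrow> 'a \<Rightarrow> 'a \<Rightarrow> nat \<Rightarrow> 'a" where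
  "hyp_coeff p q s k = (-1)^k * (p gchoose k) * (q gchoose k) * inverse (s gchoose k)"

text \<open>The coefficient of \<open>t^i\<close> in the product 2F1(-\<alpha>, -\<beta>; 1; t) *
  2F1(-p, -q; -s; t).\<close>

definition hyp_conv :: "'a::field_char_0 \<Rightarrow> 'a \<Rightarrow> 'a \<Rightarrow> 'a \<Rightarrow> 'a \<Rightarrow> nat \<Rightarrow> 'a" where
  "hyp_conv \<alpha> \<beta> p q s i =
    (\<Sum>k=0..i. (\<alpha> gchoose (i - k)) * (\<beta> gchoose (i - k)) * hyp_coeff p q s k)"

text \<open>Leading coefficient first: this is X^d times the series in 1/X with coefficients
  \<open>c\<close>, cut off after the term X^0.\<close>

definition rev_poly :: "nat \<Rightarrow> (nat \<Rightarrow> 'a::comm_ring_1) \<Rightarrow> 'a poly" where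
  "rev_poly d c = (\<Sum>i=0..d. monom (c i) (d - i))"

lemma gbinomial_of_nat_nonzero:
  assumes "k \<le> S"
  shows "(of_nat S gchoose k :: 'a::field_char_0) \<noteq> 0"
  using assms by (simp flip: binomial_gbinomial)

lemma gbinomial_absorb:
  fixes p :: "'a::field_char_0"
  shows "p gchoose (Suc k) = p * ((p - 1) gchoose k) / of_nat (Suc k)"
  using gbinomial_factors[of "p - 1" k] by simp

lemma gbinomial_shift:
  fixes p :: "'a::field_char_0"
  shows "(p - of_nat k) * (p gchoose k) = p * ((p - 1) gchoose k)"
  by (metis gbinomial_absorb_comp)

section \<open>Contiguous relation for the Gauss series and for the product\<close>

lemma hyp_coeff_0 [simp]: "hyp_coeff p q s 0 = 1"
  by (simp add: hyp_coeff_def)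

lemma hyp_coeff_1 [simp]: "hyp_coeff p q s (Suc 0) = - p * q / s"
  by (simp add: hyp_coeff_def divide_inverse)

text \<open>The bound on \<open>k\<close> keeps the relation away from \<open>s gchoose k = 0\<close>, where \<open>hyp_coeff\<close> is a junk value.\<close>
lemma hyp_coeff_contiguous:
  fixes p q s :: "'a::field_char_0"
  assumes s: "s = of_nat S" and k: "k + 2 \<le> S"
  shows "hyp_coeff (p+1) (q+1) (s+2) (k+2) = hyp_coeff p q s (k+2)
     - ((p+1)*(q+1)/(s+2) - p*q/s) * hyp_coeff p q s (k+1)
     - p*q*(s-p)*(s-q)/(s^2*(s^2-1)) * hyp_coeff (p-1) (q-1) (s-2) k"
proof -
  define K :: 'a where "K = of_nat k"
  define u where "u = (p - 1 gchoose k)"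
  define v where "v = (q - 1 gchoose k)"
  define w where "w = (s - 2 gchoose k)"
  obtain T where T: "S = T + 2" using k by (metis add.commute le_Suc_ex le_trans le_add2)
  have kT: "k \<le> T" using k T by simp
  have s2: "s - 2 = of_nat T" using s T by simp
  have w0: "w \<noteq> 0" unfolding w_def s2 using kT by (rule gbinomial_of_nat_nonzero)
  have "K + 1 = of_nat (k + 1)" "K + 2 = of_nat (k + 2)" by (simp_all add: K_def)
  then have K0: "K + 1 \<noteq> 0" "K + 2 \<noteq> 0" by (simp_all only: of_nat_eq_0_iff)
  have "s = of_nat (T + 2)" "s - 1 = of_nat (T + 1)" "s + 1 = of_nat (T + 3)" "s + 2 = of_nat (T + 4)"
    by (simp_all add: s T)
  then have s0: "s \<noteq> 0" and s1: "s - 1 \<noteq> 0" and sp1: "s + 1 \<noteq> 0" and sp2: "s + 2 \<noteq> 0"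
    by (simp_all only: of_nat_eq_0_iff)
  have "s - 1 - K = of_nat (T + 1 - k)" "s - K = of_nat (T + 2 - k)"
    using kT by (simp_all add: s T K_def of_nat_diff)
  then have sK1: "s - 1 - K \<noteq> 0" and sK: "s - K \<noteq> 0"
    using kT by (simp_all only: of_nat_eq_0_iff)
  \<comment> \<open>All binomials at \<open>x + 1\<close> and \<open>x\<close> are reduced to
    \<open>x - 1 gchoose k\<close>, which prepares a common factor of the four terms.\<close>
  have up: "(x + 1 gchoose (k+2)) = (x + 1) * x * (x - 1 gchoose k) / ((K + 2) * (K + 1))"
       "(x gchoose (k+1)) = x * (x - 1 gchoose k) / (K + 1)"
       "(x gchoose (k+2)) = x * (x - 1 - K) * (x - 1 gchoose k) / ((K + 2) * (K + 1))" for x :: 'a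
  proof -
    show "(x + 1 gchoose (k+2)) = (x + 1) * x * (x - 1 gchoose k) / ((K + 2) * (K + 1))"
      using gbinomial_absorb[of "x + 1" "Suc k"] gbinomial_absorb[of x k]
      by (simp add: K_def algebra_simps)
    show *: "(x gchoose (k+1)) = x * (x - 1 gchoose k) / (K + 1)"
      using gbinomial_absorb[of x k] by (simp add: K_def algebra_simps)
    have "(x - 1 - K) * (x - 1 gchoose k) = (x - 1) * (x - 1 - 1 gchoose k)"
      unfolding K_def by (rule gbinomial_shift)
    then show "(x gchoose (k+2)) = x * (x - 1 - K) * (x - 1 gchoose k) / ((K + 2) * (K + 1))"
      using gbinomial_absorb[of x "Suc k"] gbinomial_absorb[of "x - 1" k]
      by (simp add: K_def add.commute mult.assoc)
  qed
  \<comment> \<open>For \<open>s\<close> the reduction goes one step further, down to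
    \<open>w\<close>, because \<open>s\<close> moves by 2 where \<open>p\<close> and
    \<open>q\<close> move by 1.\<close>
  have sm: "(s - 1 - K) * (s - 1 gchoose k) = (s - 1) * w"
    using gbinomial_shift[of "s - 1" k] by (simp add: K_def w_def)
  then have sm1: "(s - 1 gchoose k) = (s - 1) * w / (s - 1 - K)"
    using sK1 by (simp add: nonzero_eq_divide_eq mult.commute)
  have "(s - K) * (s gchoose k) = s * (s - 1 gchoose k)"
    unfolding K_def by (rule gbinomial_shift)
  then have "(s gchoose k) = s * (s - 1 gchoose k) / (s - K)"
    using sK by (simp add: nonzero_eq_divide_eq mult.commute)
  then have sk: "(s gchoose k) = s * (s - 1) * w / ((s - K) * (s - 1 - K))"
    by (simp add: sm1 mult_ac)
  have sa: "(s + 2 gchoose (k+2)) = (s + 2) * (s + 1) * s * (s - 1) * w / ((s - K) * (s - 1 - K) * (K + 2) * (K + 1))"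
    using up(1)[of "s + 1"] sk by (simp add: algebra_simps)
  have sb: "(s gchoose (k+1)) = s * (s - 1) * w / ((s - 1 - K) * (K + 1))"
    using up(2)[of s] sm1 by simp
  have sc: "(s gchoose (k+2)) = s * (s - 1) * w / ((K + 2) * (K + 1))"
    unfolding up(3)[of s] mult.assoc sm by simp
  \<comment> \<open>The four terms share the factor \<open>(-1)^k * u * v / w\<close>; once it is
    split off, a rational identity in \<open>p\<close>, \<open>q\<close>, \<open>s\<close>,
    \<open>K\<close> remains.\<close>
  have h1: "hyp_coeff (p+1) (q+1) (s+2) (k+2) = (-1)^k * u * v / w *
      ((p+1) * p * (q+1) * q * (s - K) * (s - 1 - K) / ((s+2)*(s+1)*s*(s-1)*(K+2)*(K+1)))"
    unfolding hyp_coeff_def up(1) sa u_def[symmetric] v_def[symmetric]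
    using w0 K0 s0 s1 sp1 sp2 sK1 sK by (simp add: divide_simps)
  have h2: "hyp_coeff p q s (k+2) = (-1)^k * u * v / w *
      (p * (p - 1 - K) * q * (q - 1 - K) / (s*(s-1)*(K+2)*(K+1)))"
    unfolding hyp_coeff_def up(3)[of p] up(3)[of q] sc u_def[symmetric] v_def[symmetric]
    using w0 K0 s0 s1 by (simp add: divide_simps)
  have h3: "hyp_coeff p q s (k+1) = (-1)^k * u * v / w *
      (- p * q * (s - 1 - K) / (s*(s-1)*(K+1)))"
    unfolding hyp_coeff_def up(2)[of p] up(2)[of q] sb u_def[symmetric] v_def[symmetric]
    using w0 K0 s0 s1 sK1 by (simp add: divide_simps)
  have h4: "hyp_coeff (p-1) (q-1) (s-2) k = (-1)^k * u * v / w"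
    by (simp add: hyp_coeff_def u_def v_def w_def divide_inverse)
  have s21: "s^2 - 1 = (s - 1) * (s + 1)" by (simp add: power2_eq_square algebra_simps)
  note nz = K0 s0 s1 sp1 sp2
  have id: "(p+1) * p * (q+1) * q * (s - K) * (s - 1 - K) / ((s+2)*(s+1)*s*(s-1)*(K+2)*(K+1))
     = p * (p - 1 - K) * q * (q - 1 - K) / (s*(s-1)*(K+2)*(K+1))
      - ((p+1)*(q+1)/(s+2) - p*q/s) * (- p * q * (s - 1 - K) / (s*(s-1)*(K+1)))
      - p*q*(s-p)*(s-q)/(s^2*((s-1)*(s+1)))"
  proof -
    \<comment> \<open>Up to sign, these are the numerators of the four terms over a common
      denominator, with \<open>p * q\<close> taken out; the claim is then a polynomial
      identity.\<close>
    define N1 N2 N3 N4 where "N1 = (p+1) * (q+1) * (s - K) * (s - 1 - K) * s"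
     and "N2 = (p - 1 - K) * (q - 1 - K) * (s*(s+1)*(s+2))"
     and "N3 = ((p+1)*(q+1)*s - p*q*(s+2)) * (s - 1 - K) * (K+2)*(s+1)"
     and "N4 = (s-p)*(s-q)*(K+1)*(K+2)*(s+2)"
    have N: "N1 = N2 + N3 - N4" unfolding N1_def N2_def N3_def N4_def by algebra
    define D where "D = s^2*(s-1)*(s+1)*(s+2)*(K+1)*(K+2)"
    have "(p+1) * p * (q+1) * q * (s - K) * (s - 1 - K) / ((s+2)*(s+1)*s*(s-1)*(K+2)*(K+1)) = p*q*N1/D"
      using nz by (simp add: N1_def D_def divide_simps power2_eq_square)
    moreover have "p * (p - 1 - K) * q * (q - 1 - K) / (s*(s-1)*(K+2)*(K+1)) = p*q*N2/D"
      using nz by (simp add: N2_def D_def divide_simps power2_eq_square)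
    moreover have "((p+1)*(q+1)/(s+2) - p*q/s) * (- p * q * (s - 1 - K) / (s*(s-1)*(K+1))) = - (p*q*N3/D)"
    proof -
      have "(p+1)*(q+1)/(s+2) - p*q/s = ((p+1)*(q+1)*s - p*q*(s+2)) / (s*(s+2))"
        using nz by (simp add: divide_simps)
      then show ?thesis 
        using nz by (simp add: N3_def D_def divide_simps power2_eq_square)
    qed
    moreover have "p*q*(s-p)*(s-q)/(s^2*((s-1)*(s+1))) = p*q*N4/D"
      using nz by (simp add: N4_def D_def divide_simps)
    ultimately show ?thesis by (simp add: N ring_distribs add_divide_distrib diff_divide_distrib)
  qed
  have factor: "c * (x - y * z - t) = c * x - y * (c * z) - t * c" for c x y z t :: 'a
    by (simp add: algebra_simps)
  show ?thesis
    unfolding h1 h2 h3 h4 s21 id by (rule factor)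
qed

lemma hyp_conv_fps:
  "hyp_conv \<alpha> \<beta> p q s i =
    (Abs_fps (hyp_coeff p q s) * Abs_fps (\<lambda>j. (\<alpha> gchoose j) * (\<beta> gchoose j))) $ i"
  by (simp add: hyp_conv_def fps_mult_nth mult.commute)

text \<open>The factor built from \<alpha> and \<beta> is the same in all three products, so
  multiplying by it preserves the relation. Orders 0 and 1 are separate because the terms with
  factors t and t^2 enter only at orders 1 and 2.\<close>

lemma hyp_conv_contiguous:
  fixes p q s :: "'a::field_char_0" and \<alpha> \<beta> :: 'a
  defines "a \<equiv> (p+1)*(q+1)/(s+2) - p*q/s" and "b \<equiv> p*q*(s-p)*(s-q)/(s^2*(s^2-1))"
  assumes s: "s = of_nat S"
  shows "hyp_conv \<alpha> \<beta> (p+1) (q+1) (s+2) 0 = hyp_conv \<alpha> \<beta> p q s 0"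
    and "hyp_conv \<alpha> \<beta> (p+1) (q+1) (s+2) (Suc 0)
       = hyp_conv \<alpha> \<beta> p q s (Suc 0) - a * hyp_conv \<alpha> \<beta> p q s 0"
    and "i + 2 \<le> S \<Longrightarrow> hyp_conv \<alpha> \<beta> (p+1) (q+1) (s+2) (i+2) = hyp_conv \<alpha> \<beta> p q s (i+2)
       - a * hyp_conv \<alpha> \<beta> p q s (i+1) - b * hyp_conv \<alpha> \<beta> (p-1) (q-1) (s-2) i"
proof -
  show "hyp_conv \<alpha> \<beta> (p+1) (q+1) (s+2) 0 = hyp_conv \<alpha> \<beta> p q s 0"
    by (simp add: hyp_conv_def)
  show "hyp_conv \<alpha> \<beta> (p+1) (q+1) (s+2) (Suc 0)
       = hyp_conv \<alpha> \<beta> p q s (Suc 0) - a * hyp_conv \<alpha> \<beta> p q s 0"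
    by (simp add: hyp_conv_def a_def algebra_simps add_divide_distrib diff_divide_distrib)
next
  assume i: "i + 2 \<le> S"
  \<comment> \<open>\<open>R\<close> is the defect of the contiguous relation for \<open>G\<close>; it need not vanish beyond order \<open>S\<close>.\<close>
  define F where "F = Abs_fps (\<lambda>j. (\<alpha> gchoose j) * (\<beta> gchoose j))"
  define G where "G = (\<lambda>p q s :: 'a. Abs_fps (hyp_coeff p q s))"
  define R where "R = G (p+1) (q+1) (s+2) - G p q s + fps_X * (fps_const a * G p q s)
    + fps_X * (fps_X * (fps_const b * G (p-1) (q-1) (s-2)))"
  have R: "R $ k = 0" if "k \<le> i + 2" for k
  proof -
    consider "k = 0" | "k = 1" | j where "k = j + 2"
      by (metis One_nat_def add_2_eq_Suc' old.nat.exhaust)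
    then show ?thesis
    proof cases
      case 3
      then have "j + 2 \<le> S" using that i by simp
      from hyp_coeff_contiguous[OF s this, of p q] show ?thesis
        using 3 by (simp add: R_def G_def a_def b_def algebra_simps)
    qed (simp_all add: R_def G_def a_def algebra_simps add_divide_distrib diff_divide_distrib)
  qed
  \<comment> \<open>Order \<open>i + 2\<close> of the product sees only coefficients of
    \<open>R\<close> up to that order, and these vanish.\<close>
  have "(R * F) $ (i+2) = 0"
    by (simp add: fps_mult_nth R)
  moreover have "R * F = G (p+1) (q+1) (s+2) * F - G p q s * F
    + fps_X * (fps_const a * (G p q s * F))
    + fps_X * (fps_X * (fps_const b * (G (p-1) (q-1) (s-2) * F)))"
    unfolding R_def by (simp add: algebra_simps)
  ultimately have "(G (p+1) (q+1) (s+2) * F) $ (i+2) - (G p q s * F) $ (i+2)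
    + a * (G p q s * F) $ (i+1) + b * (G (p-1) (q-1) (s-2) * F) $ i = 0"
    by simp
  then show "hyp_conv \<alpha> \<beta> (p+1) (q+1) (s+2) (i+2) = hyp_conv \<alpha> \<beta> p q s (i+2)
       - a * hyp_conv \<alpha> \<beta> p q s (i+1) - b * hyp_conv \<alpha> \<beta> (p-1) (q-1) (s-2) i"
    unfolding hyp_conv_fps G_def F_def by (simp add: algebra_simps)
qed

section \<open>Vanishing of the coefficient just beyond the degree\<close>

text \<open>Negating the upper entry of the second binomial gives \<alpha> - (m - k), and trinomial
  revision applies. The non-integral part that remains is independent of \<open>k\<close>.\<close>

lemma gbinomial_mult_complement:
  fixes \<alpha> :: "'a::field_char_0"
  assumes "k \<le> m"
  shows "(\<alpha> gchoose (m - k)) * (of_nat m - 1 - \<alpha> gchoose k) = (-1)^k * (\<alpha> gchoose m) * of_nat (m choose k)"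
proof -
  have "(of_nat m - 1 - \<alpha> gchoose k) = (-1)^k * (\<alpha> - of_nat (m - k) gchoose k)"
    using gbinomial_negated_upper[of "of_nat m - 1 - \<alpha>" k] assms
    by (simp add: of_nat_diff algebra_simps)
  moreover have "(\<alpha> gchoose m) * (of_nat m gchoose (m - k))
      = (\<alpha> gchoose (m - k)) * (\<alpha> - of_nat (m - k) gchoose (m - (m - k)))"
    by (rule gbinomial_trinomial_revision) simp
  moreover have "(of_nat m gchoose (m - k) :: 'a) = of_nat (m choose k)"
    using assms by (simp add: binomial_symmetric[of k m] flip: binomial_gbinomial)
  ultimately show ?thesis using assms by simp
qed

text \<open>Trinomial revision leaves \<open>(S - k) choose (m - k)\<close>; negating its upper
  entry removes \<open>k\<close> from it, as Vandermonde's convolution requires.\<close>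

lemma binomial_ratio:
  assumes "k \<le> m" "m \<le> S"
  shows "of_nat (m choose k) / (of_nat (S choose k) :: 'a::field_char_0)
    = (-1)^(m - k) * (of_nat m - of_nat S - 1 gchoose (m - k)) / of_nat (S choose m)"
proof -
  have "(of_nat m - of_nat S - 1 gchoose (m - k) :: 'a)
      = (-1)^(m - k) * (of_nat (S - k) gchoose (m - k))"
    using gbinomial_negated_upper[of "of_nat m - of_nat S - 1 :: 'a" "m - k"] assms
    by (simp add: of_nat_diff algebra_simps)
  then have "(-1)^(m - k) * (of_nat m - of_nat S - 1 gchoose (m - k) :: 'a)
      = of_nat ((S - k) choose (m - k))"
    by (simp flip: binomial_gbinomial mult.assoc power_add)
  moreover have "(S choose m) * (m choose k) = (S choose k) * ((S - k) choose (m - k))"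
    using assms by (rule choose_mult)
  then have "of_nat (S choose m) * of_nat (m choose k)
      = (of_nat (S choose k) * of_nat ((S - k) choose (m - k)) :: 'a)"
    by (metis of_nat_mult)
  ultimately show ?thesis
    using assms by (simp add: field_simps)
qed

lemma gbinomial_of_nat_eq_0:
  assumes "m < k"
  shows "(of_nat m gchoose k :: 'a::field_char_0) = 0"
  using assms by (simp flip: binomial_gbinomial)

text \<open>By \<open>binomial_ratio\<close> this is a Vandermonde sum with value a multiple of 2m -
  S - 1 over m. The hypotheses make the upper entry a natural number below \<open>m\<close>, so this
  binomial is 0.\<close>

lemma alternating_binomial_ratio_sum:
  assumes "m \<le> S" "S < 2 * m"
  shows "(\<Sum>k=0..m. (-1)^k * (of_nat (m choose k))^2 / (of_nat (S choose k) :: 'a::field_char_0)) = 0"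
proof -
  have "(\<Sum>k=0..m. (-1)^k * (of_nat (m choose k))^2 / (of_nat (S choose k) :: 'a))
    = (\<Sum>k=0..m. (-1)^m / of_nat (S choose m)
        * ((of_nat m gchoose k) * (of_nat m - of_nat S - 1 gchoose (m - k))))"
  proof (rule sum.cong)
    fix k assume "k \<in> {0..m}"
    then have k: "k \<le> m" by simp
    have "(-1)^k * (of_nat (m choose k))^2 / (of_nat (S choose k) :: 'a)
       = (-1)^k * of_nat (m choose k) * (of_nat (m choose k) / of_nat (S choose k))"
      by (simp add: power2_eq_square)
    also have "\<dots> = ((-1)^k * (-1)^(m - k)) / of_nat (S choose m)
        * ((of_nat m gchoose k) * (of_nat m - of_nat S - 1 gchoose (m - k)))"
      unfolding binomial_ratio[OF k assms(1)] by (simp add: binomial_gbinomial)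
    also have "(-1)^k * (-1)^(m - k) = ((-1)^m :: 'a)"
      using k by (simp flip: power_add)
    finally show "(-1)^k * (of_nat (m choose k))^2 / (of_nat (S choose k) :: 'a)
      = (-1)^m / of_nat (S choose m)
        * ((of_nat m gchoose k) * (of_nat m - of_nat S - 1 gchoose (m - k)))" .
  qed simp
  also have "\<dots> = (-1)^m / of_nat (S choose m) * (of_nat m + (of_nat m - of_nat S - 1) gchoose m)"
    by (simp only: gbinomial_Vandermonde sum_distrib_left[symmetric])
  also have "of_nat m + (of_nat m - of_nat S - 1) = (of_nat (2 * m - S - 1) :: 'a)"
    using assms by (simp add: of_nat_diff)
  also have "\<dots> gchoose m = 0"
    using assms by (intro gbinomial_of_nat_eq_0) simp
  finally show ?thesis by simp
qed

text \<open>The weight is absorbed by k (m choose k) = m (m - 1 choose k - 1); the Vandermonde sum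
  then gives 2m - S - 2 over m - 1, again with a natural upper entry below the lower one.\<close>

lemma alternating_binomial_ratio_sum_weighted:
  assumes "m \<le> S" "S + 2 \<le> 2 * m"
  shows "(\<Sum>k=0..m. (-1)^k * of_nat k * (of_nat (m choose k))^2 / (of_nat (S choose k) :: 'a::field_char_0)) = 0"
proof -
  obtain M where M: "m = Suc M" using assms by (cases m) auto
  \<comment> \<open>The weight kills the summand at \<open>k = 0\<close>, so the sum can be
    reindexed for the absorption.\<close>
  have "(\<Sum>k=0..m. (-1)^k * of_nat k * (of_nat (m choose k))^2 / (of_nat (S choose k) :: 'a))
    = (\<Sum>k=Suc 0..Suc M. (-1)^k * of_nat k * (of_nat (m choose k))^2 / (of_nat (S choose k) :: 'a))"
    unfolding M by (subst sum.atLeast_Suc_atMost) auto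
  also have "\<dots> = (\<Sum>k=0..M. (-1)^Suc k * of_nat (Suc k) * (of_nat (m choose Suc k))^2 / (of_nat (S choose Suc k) :: 'a))"
    by (rule sum.shift_bounds_cl_Suc_ivl)
  also have "\<dots> = (\<Sum>k=0..M. (-1)^m * of_nat m / of_nat (S choose m)
        * ((of_nat M gchoose k) * (of_nat m - of_nat S - 1 gchoose (M - k))))"
  proof (rule sum.cong)
    fix k assume "k \<in> {0..M}"
    then have k: "k \<le> M" and k': "Suc k \<le> m" by (simp_all add: M)
    have ab: "of_nat (Suc k) * of_nat (m choose Suc k) = (of_nat m * of_nat (M choose k) :: 'a)"
      using binomial_absorption[of k m] by (simp only: M diff_Suc_1 flip: of_nat_mult)
    have "(-1)^Suc k * of_nat (Suc k) * (of_nat (m choose Suc k))^2 / (of_nat (S choose Suc k) :: 'a)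
       = (-1)^Suc k * (of_nat (Suc k) * of_nat (m choose Suc k))
          * (of_nat (m choose Suc k) / of_nat (S choose Suc k))"
      by (simp only: power2_eq_square divide_inverse mult_ac)
    also have "\<dots> = ((-1)^Suc k * (-1)^(m - Suc k)) * of_nat m / of_nat (S choose m)
        * ((of_nat M gchoose k) * (of_nat m - of_nat S - 1 gchoose (m - Suc k)))"
      unfolding ab binomial_ratio[OF k' assms(1)] by (simp only: binomial_gbinomial divide_inverse mult_ac)
    also have "(-1)^Suc k * (-1)^(m - Suc k) = ((-1)^m :: 'a)"
      by (simp only: power_add[symmetric] le_add_diff_inverse[OF k'])
    finally show "(-1)^Suc k * of_nat (Suc k) * (of_nat (m choose Suc k))^2 / (of_nat (S choose Suc k) :: 'a)
      = (-1)^m * of_nat m / of_nat (S choose m)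
        * ((of_nat M gchoose k) * (of_nat m - of_nat S - 1 gchoose (M - k)))"
      by (simp add: M)
  qed simp
  also have "\<dots> = (-1)^m * of_nat m / of_nat (S choose m) * (of_nat M + (of_nat m - of_nat S - 1) gchoose M)"
    by (simp only: gbinomial_Vandermonde sum_distrib_left[symmetric])
  also have "of_nat M + (of_nat m - of_nat S - 1) = (of_nat (2 * m - S - 2) :: 'a)"
    using assms by (simp add: of_nat_diff M)
  also have "\<dots> gchoose M = 0"
    using assms by (intro gbinomial_of_nat_eq_0) (simp add: M)
  finally show ?thesis by simp
qed

text \<open>Both upper entries are complements in the sense of
  \<open>gbinomial_mult_complement\<close>, so the sum is a constant multiple of the alternating
  sum.\<close>

lemma hyp_conv_eq_0:
  fixes \<alpha> \<beta> :: "'a::field_char_0"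
  assumes "m \<le> S" "S < 2 * m"
  shows "hyp_conv \<alpha> \<beta> (of_nat m - 1 - \<alpha>) (of_nat m - 1 - \<beta>) (of_nat S) m = 0"
proof -
  have "hyp_conv \<alpha> \<beta> (of_nat m - 1 - \<alpha>) (of_nat m - 1 - \<beta>) (of_nat S) m
    = (\<Sum>k=0..m. (\<alpha> gchoose m) * (\<beta> gchoose m)
        * ((-1)^k * (of_nat (m choose k))^2 / of_nat (S choose k)))"
    unfolding hyp_conv_def
  proof (rule sum.cong)
    fix k assume "k \<in> {0..m}"
    then have k: "k \<le> m" by simp
    have "(\<alpha> gchoose (m - k)) * (\<beta> gchoose (m - k)) * hyp_coeff (of_nat m - 1 - \<alpha>) (of_nat m - 1 - \<beta>) (of_nat S) k
      = (-1)^k * ((\<alpha> gchoose (m - k)) * (of_nat m - 1 - \<alpha> gchoose k))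
        * ((\<beta> gchoose (m - k)) * (of_nat m - 1 - \<beta> gchoose k)) / of_nat (S choose k)"
      by (simp add: hyp_coeff_def divide_inverse mult_ac flip: binomial_gbinomial)
    also have "\<dots> = (\<alpha> gchoose m) * (\<beta> gchoose m)
        * ((-1)^k * (of_nat (m choose k))^2 / of_nat (S choose k))"
      unfolding gbinomial_mult_complement[OF k] by (simp add: power2_eq_square)
    finally show "(\<alpha> gchoose (m - k)) * (\<beta> gchoose (m - k)) * hyp_coeff (of_nat m - 1 - \<alpha>) (of_nat m - 1 - \<beta>) (of_nat S) k
      = (\<alpha> gchoose m) * (\<beta> gchoose m) * ((-1)^k * (of_nat (m choose k))^2 / of_nat (S choose k))" .
  qed simp
  then show ?thesis
    by (simp only: sum_distrib_left[symmetric] alternating_binomial_ratio_sum[OF assms] mult_zero_right)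
qed

text \<open>Lowering the second upper entry from y to y - 1 multiplies the k-th binomial by 1 - k/y;
  the two parts of this factor give the plain and the weighted alternating sum.\<close>

lemma hyp_conv_eq_0_shifted:
  fixes \<alpha> \<beta> :: "'a::field_char_0"
  assumes "m \<le> S" "S + 2 \<le> 2 * m" and nz: "of_nat m - 1 - \<beta> \<noteq> 0"
  shows "hyp_conv \<alpha> \<beta> (of_nat m - 1 - \<alpha>) (of_nat m - 2 - \<beta>) (of_nat S) m = 0"
proof -
  define y where "y = of_nat m - 1 - \<beta>"
  have y0: "y \<noteq> 0" using nz by (simp add: y_def)
  have less: "S < 2 * m" using assms(2) by simp
  have "hyp_conv \<alpha> \<beta> (of_nat m - 1 - \<alpha>) (of_nat m - 2 - \<beta>) (of_nat S) m
    = (\<Sum>k=0..m. (\<alpha> gchoose m) * (\<beta> gchoose m)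
        * ((-1)^k * (of_nat (m choose k))^2 / of_nat (S choose k))
       - (\<alpha> gchoose m) * (\<beta> gchoose m) / y
        * ((-1)^k * of_nat k * (of_nat (m choose k))^2 / of_nat (S choose k)))"
    unfolding hyp_conv_def
  proof (rule sum.cong)
    fix k assume "k \<in> {0..m}"
    then have k: "k \<le> m" by simp
    have "of_nat m - 2 - \<beta> gchoose k = (y - of_nat k) / y * (of_nat m - 1 - \<beta> gchoose k)"
      using gbinomial_shift[of y k] y0 by (simp add: y_def field_simps)
    then have "(\<alpha> gchoose (m - k)) * (\<beta> gchoose (m - k)) * hyp_coeff (of_nat m - 1 - \<alpha>) (of_nat m - 2 - \<beta>) (of_nat S) k
      = (y - of_nat k) / y * ((-1)^k * ((\<alpha> gchoose (m - k)) * (of_nat m - 1 - \<alpha> gchoose k))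
        * ((\<beta> gchoose (m - k)) * (of_nat m - 1 - \<beta> gchoose k)) / of_nat (S choose k))"
      by (simp add: hyp_coeff_def divide_inverse mult_ac flip: binomial_gbinomial)
    also have "\<dots> = (y - of_nat k) / y * ((\<alpha> gchoose m) * (\<beta> gchoose m)
        * ((-1)^k * (of_nat (m choose k))^2 / of_nat (S choose k)))"
      unfolding gbinomial_mult_complement[OF k] by (simp add: power2_eq_square)
    also have "\<dots> = (\<alpha> gchoose m) * (\<beta> gchoose m)
        * ((-1)^k * (of_nat (m choose k))^2 / of_nat (S choose k))
       - (\<alpha> gchoose m) * (\<beta> gchoose m) / y
        * ((-1)^k * of_nat k * (of_nat (m choose k))^2 / of_nat (S choose k))"
      using y0 by (simp add: diff_divide_distrib algebra_simps)
    finally show "(\<alpha> gchoose (m - k)) * (\<beta> gchoose (m - k)) * hyp_coeff (of_nat m - 1 - \<alpha>) (of_nat m - 2 - \<beta>) (of_nat S) k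
      = (\<alpha> gchoose m) * (\<beta> gchoose m)
        * ((-1)^k * (of_nat (m choose k))^2 / of_nat (S choose k))
       - (\<alpha> gchoose m) * (\<beta> gchoose m) / y
        * ((-1)^k * of_nat k * (of_nat (m choose k))^2 / of_nat (S choose k))" .
  qed simp
  also have "\<dots> = (\<alpha> gchoose m) * (\<beta> gchoose m)
        * (\<Sum>k=0..m. (-1)^k * (of_nat (m choose k))^2 / of_nat (S choose k))
       - (\<alpha> gchoose m) * (\<beta> gchoose m) / y
        * (\<Sum>k=0..m. (-1)^k * of_nat k * (of_nat (m choose k))^2 / of_nat (S choose k))"
    by (simp only: sum_subtractf sum_distrib_left)
  also have "\<dots> = 0"
    unfolding alternating_binomial_ratio_sum[OF assms(1) less]
      alternating_binomial_ratio_sum_weighted[OF assms(1,2)] by simp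
  finally show ?thesis .
qed

section \<open>From coefficient recursions to polynomial recursions\<close>

lemma coeff_rev_poly:
  "coeff (rev_poly d c) j = (if j \<le> d then c (d - j) else 0)"
proof -
  have "coeff (rev_poly d c) j = (\<Sum>i=0..d. if d - i = j then c i else 0)"
    by (simp add: rev_poly_def coeff_sum)
  also have "\<dots> = (\<Sum>i=0..d. if j \<le> d \<and> i = d - j then c i else 0)"
    by (intro sum.cong) auto
  also have "\<dots> = (if j \<le> d then c (d - j) else 0)"
    by (simp add: sum.delta)
  finally show ?thesis .
qed

lemma degree_rev_poly:
  assumes "c 0 \<noteq> 0"
  shows "degree (rev_poly d c) = d"
  using assms by (intro antisym degree_le le_degree) (auto simp: coeff_rev_poly)

lemma rev_poly_recursion:
  assumes "d \<ge> 1"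
    and "c2 0 = c1 0" "c2 (Suc 0) = c1 (Suc 0) - a * c1 0"
    and rec: "\<And>i. i + 1 \<le> d \<Longrightarrow> c2 (i + 2) = c1 (i + 2) - a * c1 (i + 1) - b * c0 i"
    and "c1 (d + 1) = 0"
  shows "rev_poly (d + 1) c2 = [:-a, 1:] * rev_poly d c1 - smult b (rev_poly (d - 1) c0)"
proof (rule poly_eqI)
  fix j
  have c: "coeff ([:-a, 1:] * rev_poly d c1 - smult b (rev_poly (d - 1) c0)) j
     = - a * coeff (rev_poly d c1) j + (case j of 0 \<Rightarrow> 0 | Suc l \<Rightarrow> coeff (rev_poly d c1) l)
       - b * coeff (rev_poly (d - 1) c0) j"
    by (simp add: coeff_pCons)
  consider "j > d + 1" | "j = d + 1" | "j = d" | "j < d" by linarith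
  then show "coeff (rev_poly (d + 1) c2) j
    = coeff ([:-a, 1:] * rev_poly d c1 - smult b (rev_poly (d - 1) c0)) j"
  proof cases
    case 4
    define i where "i = d - 1 - j"
    have i: "d + 1 - j = i + 2" "d - j = i + 1" "i + 1 \<le> d" using 4 by (auto simp: i_def)
    have c2: "coeff (rev_poly (d + 1) c2) j = c2 (i + 2)"
      unfolding coeff_rev_poly i(1) using 4 by simp
    have c1: "coeff (rev_poly d c1) j = c1 (i + 1)"
      unfolding coeff_rev_poly i(2) using 4 by simp
    have c0: "coeff (rev_poly (d - 1) c0) j = c0 i"
      unfolding coeff_rev_poly i_def using 4 by simp
    have c1': "(case j of 0 \<Rightarrow> 0 | Suc l \<Rightarrow> coeff (rev_poly d c1) l) = c1 (i + 2)"
    proof (cases j)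
      \<comment> \<open>The constant term of the new polynomial would involve
        \<open>c1 (d + 1)\<close>, which the truncated \<open>rev_poly d c1\<close> lacks; this is
        where its vanishing enters.\<close>
      case 0
      then have "i + 2 = d + 1" using i(1) by simp
      then show ?thesis using 0 assms(5) by simp
    next
      case (Suc l)
      then have "l \<le> d" "d - l = i + 2" using i(1) 4 by auto
      then show ?thesis using Suc by (simp add: coeff_rev_poly)
    qed
    show ?thesis unfolding c c2 c1 c0 c1' rec[OF i(3)] by simp
  next
    case 3
    then obtain l where "d = Suc l" using assms(1) by (cases d) auto
    with 3 assms show ?thesis unfolding c by (simp add: coeff_rev_poly)
  next
    case 1
    then show ?thesis unfolding c by (cases j) (auto simp: coeff_rev_poly)
  next
    case 2
    then show ?thesis unfolding c using assms(2) by (simp add: coeff_rev_poly)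
  qed
qed

text \<open>The factor is 1728^i, from the substitution t = 1728/X.\<close>

definition hyp_poly :: "rat \<Rightarrow> rat \<Rightarrow> nat \<Rightarrow> rat \<Rightarrow> rat \<Rightarrow> rat \<Rightarrow> rat poly" where
  "hyp_poly \<alpha> \<beta> d p q s = rev_poly d (\<lambda>i. 12^(3*i) * hyp_conv \<alpha> \<beta> p q s i)"

lemma degree_hyp_poly: "degree (hyp_poly \<alpha> \<beta> d p q s) = d"
  unfolding hyp_poly_def by (rule degree_rev_poly) (simp add: hyp_conv_def)

text \<open>Rescaling by 1728^i puts 1728 into \<open>a\<close> and 1728^2 into \<open>b\<close>.
  The shifted parameters are variables with equations, so that the rule matches differently written
  terms and leaves arithmetic side goals.\<close>

lemma hyp_poly_recursion:
  assumes s: "s = of_nat S" and "1 \<le> d" "d + 1 \<le> S"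
    and vanish: "hyp_conv \<alpha> \<beta> p q s (d + 1) = 0"
    and "a = 1728 * ((p+1)*(q+1)/(s+2) - p*q/s)"
    and "b = 1728^2 * (p*q*(s-p)*(s-q)/(s^2*(s^2-1)))"
    and "d' = d + 1" "d0 = d - 1" "p' = p + 1" "q' = q + 1" "s' = s + 2"
    and "p0 = p - 1" "q0 = q - 1" "s0 = s - 2"
  shows "hyp_poly \<alpha> \<beta> d' p' q' s' = [:-a, 1:] * hyp_poly \<alpha> \<beta> d p q s
    - smult b (hyp_poly \<alpha> \<beta> d0 p0 q0 s0)"
  unfolding assms(5-) hyp_poly_def
proof (rule rev_poly_recursion)
  fix i assume i: "i + 1 \<le> d"
  have "(12::rat)^(3*(i+2)) = 1728^2 * 12^(3*i)" "(12::rat)^(3*(i+1)) = 1728 * 12^(3*i)"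
    by (simp_all add: power_add distrib_left)
  moreover have "i + 2 \<le> S" using i assms(3) by simp
  ultimately show "12^(3*(i+2)) * hyp_conv \<alpha> \<beta> (p+1) (q+1) (s+2) (i+2)
    = 12^(3*(i+2)) * hyp_conv \<alpha> \<beta> p q s (i+2)
     - 1728 * ((p+1)*(q+1)/(s+2) - p*q/s) * (12^(3*(i+1)) * hyp_conv \<alpha> \<beta> p q s (i+1))
     - 1728^2 * (p*q*(s-p)*(s-q)/(s^2*(s^2-1))) * (12^(3*i) * hyp_conv \<alpha> \<beta> (p-1) (q-1) (s-2) i)"
    by (simp only: hyp_conv_contiguous(3)[OF s] right_diff_distrib mult_ac)
       (simp add: power2_eq_square)
qed (use assms(2,4) in \<open>simp_all add: hyp_conv_contiguous(1,2)[OF s] right_diff_distrib del: of_nat_Suc\<close>)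

section \<open>Explicit polynomials of degree at most 2, for the initial values\<close>

lemma hyp_conv_0: "hyp_conv \<alpha> \<beta> p q s 0 = 1"
  by (simp add: hyp_conv_def)

lemma hyp_conv_1: "hyp_conv \<alpha> \<beta> p q s (Suc 0) = \<alpha> * \<beta> - p * q / s"
  by (simp add: hyp_conv_def)

lemma gbinomial_2: "(x gchoose Suc (Suc 0)) = x * (x - 1) / (2 :: 'a::field_char_0)"
  using gbinomial_absorb[of x "Suc 0"] by simp

lemma hyp_conv_2: "hyp_conv \<alpha> \<beta> p q s (Suc (Suc 0)) = \<alpha> * (\<alpha> - 1) * \<beta> * (\<beta> - 1) / 4
    - \<alpha> * \<beta> * p * q / s + p * (p - 1) * q * (q - 1) / (2 * s * (s - 1))"
proof -
  \<comment> \<open>For \<open>s = 0\<close> and \<open>s = 1\<close> both sides are 0 by division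
    by zero.\<close>
  have "hyp_coeff p q s (Suc (Suc 0)) = p * (p - 1) * q * (q - 1) / (2 * s * (s - 1))"
    by (cases "s = 0 \<or> s = 1") (auto simp: hyp_coeff_def gbinomial_2 field_simps)
  then show ?thesis
    by (simp add: hyp_conv_def gbinomial_2 mult.assoc)
qed

lemma hyp_poly_0: "hyp_poly \<alpha> \<beta> 0 p q s = 1"
  by (simp add: hyp_poly_def rev_poly_def hyp_conv_0 monom_0 one_pCons)

lemma hyp_poly_1: "hyp_poly \<alpha> \<beta> (Suc 0) p q s = [:1728 * (\<alpha> * \<beta> - p * q / s), 1:]"
  unfolding hyp_poly_def rev_poly_def
  by (simp add: hyp_conv_0 hyp_conv_1 monom_Suc monom_0)

lemma hyp_poly_2: "hyp_poly \<alpha> \<beta> (Suc (Suc 0)) p q s =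
  [:1728^2 * (\<alpha> * (\<alpha> - 1) * \<beta> * (\<beta> - 1) / 4 - \<alpha> * \<beta> * p * q / s
      + p * (p - 1) * q * (q - 1) / (2 * s * (s - 1))),
    1728 * (\<alpha> * \<beta> - p * q / s), 1:]"
  unfolding hyp_poly_def rev_poly_def hyp_conv_2[symmetric] hyp_conv_1[symmetric]
  by (simp add: hyp_conv_0 monom_Suc monom_0)

section \<open>Three-term recursion in the parameter ranges that occur\<close>

text \<open>The alternatives for \<open>q\<close> are the two vanishing results at m = d + 1. The
  first serves A for r = 0, 6 and B for r = 2, 8; the second serves the other four families.\<close>

lemma hyp_poly_three_term:
  assumes S: "s = of_nat S" and d: "1 \<le> d" "d + 1 \<le> S"
    and p: "p = of_nat d - \<alpha>"
    and q: "q = of_nat d - \<beta> \<and> S \<le> 2 * d + 1 \<or> q = of_nat d - 1 - \<beta> \<and> S \<le> 2 * d \<and> of_nat d \<noteq> \<beta>"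
    and "a = 1728 * ((p+1)*(q+1)/(s+2) - p*q/s)"
    and "b = 1728^2 * (p*q*(s-p)*(s-q)/(s^2*(s^2-1)))"
    and "d' = d + 1" "d0 = d - 1" "p' = p + 1" "q' = q + 1" "s' = s + 2"
    and "p0 = p - 1" "q0 = q - 1" "s0 = s - 2"
  shows "hyp_poly \<alpha> \<beta> d' p' q' s' = [:-a, 1:] * hyp_poly \<alpha> \<beta> d p q s
    - smult b (hyp_poly \<alpha> \<beta> d0 p0 q0 s0)"
proof (rule hyp_poly_recursion[OF S d _ assms(6-)])
  show "hyp_conv \<alpha> \<beta> p q s (d + 1) = 0"
    using q
  proof
    assume "q = of_nat d - \<beta> \<and> S \<le> 2 * d + 1"
    then show ?thesis using d hyp_conv_eq_0[of "d + 1" S \<alpha> \<beta>] by (simp add: S p)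
  next
    assume "q = of_nat d - 1 - \<beta> \<and> S \<le> 2 * d \<and> of_nat d \<noteq> \<beta>"
    \<comment> \<open>In that lemma \<beta> occurs first, in the nonvanishing hypothesis, so
      \<alpha> and \<beta> are not interchanged by this instantiation.\<close>
    then show ?thesis using d hyp_conv_eq_0_shifted[of "d + 1" S \<beta> \<alpha>] by (simp add: S p)
  qed
qed

section \<open>Matching the recursion coefficients\<close>

text \<open>Here \<open>y\<close> is \<open>n\<close> for \<open>r = 0, 2\<close> and \<open>n + 1/2\<close> for \<open>r = 6, 8\<close>, so that \<open>\<kappa>\<^sub>3 = 2y - 1\<close> in all cases.\<close>
lemma a0_eq:
  assumes "y > 1/2" "s = 2*y - 1"
    and "p = y - 11/12 \<and> q = y - 7/12 \<or> p = y - 7/12 \<and> q = y - 11/12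
       \<or> p = y - 1/12 \<and> q = y - 5/12 \<or> p = y - 5/12 \<and> q = y - 1/12"
  shows "a0 y = 1728 * ((p+1)*(q+1)/(s+2) - p*q/s)"
proof -
  have "2*y - 1 \<noteq> 0" "2*y + 1 \<noteq> 0" using assms(1) by auto
  then show ?thesis
    using assms(3) unfolding a0_def assms(2)
    by (elim disjE) (simp_all add: divide_simps, algebra+)
qed

lemma a2_eq:
  assumes "y > 1/2" "s = 2*y - 1"
    and "p = y + 1/12 \<and> q = y - 7/12 \<or> p = y - 7/12 \<and> q = y + 1/12
       \<or> p = y - 13/12 \<and> q = y - 5/12 \<or> p = y - 5/12 \<and> q = y - 13/12"
  shows "a2 y = 1728 * ((p+1)*(q+1)/(s+2) - p*q/s)"
proof -
  have "2*y - 1 \<noteq> 0" "2*y + 1 \<noteq> 0" using assms(1) by auto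
  then show ?thesis
    using assms(3) unfolding a2_def assms(2)
    by (elim disjE) (simp_all add: divide_simps, algebra+)
qed

text \<open>The product p q (s - p) (s - q) is unchanged when \<open>p\<close>, \<open>q\<close>
  become \<open>s - p\<close>, \<open>s - q\<close>, which is why A and its adjoint share
  \<open>b\<close>. The pairs in reversed order come from r = 6, where y = n + 1/2.\<close>

lemma b0_eq:
  assumes "y > 1" "s = 2*y - 1"
    and "p = y - 11/12 \<and> q = y - 7/12 \<or> p = y - 7/12 \<and> q = y - 11/12
       \<or> p = y - 1/12 \<and> q = y - 5/12 \<or> p = y - 5/12 \<and> q = y - 1/12"
  shows "b0 y = 1728^2 * (p*q*(s-p)*(s-q)/(s^2*(s^2-1)))"
proof -
  have s: "s^2 - 1 = 4 * y * (y - 1)" by (simp add: assms(2) power2_eq_square algebra_simps)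
  have nz: "2*y - 1 \<noteq> 0" "y - 1 \<noteq> 0" "y \<noteq> 0" using assms(1) by auto
  have "20736 * (p*q*(s-p)*(s-q)) = (12*p) * (12*q) * (12*(s-p)) * (12*(s-q))" by (simp add: algebra_simps)
  also have "\<dots> = (12*y - 11) * (12*y - 7) * (12*y - 5) * (12*y - 1)"
    using assms(3) unfolding assms(2) by (elim disjE conjE; hypsubst) (simp_all add: algebra_simps)
  finally have N: "20736 * (p*q*(s-p)*(s-q)) = (12*y - 11) * (12*y - 7) * (12*y - 5) * (12*y - 1)" .
  have eq: "1728^2 * (p*q*(s-p)*(s-q)/(s^2*(s^2-1)))
    = 144 * (20736 * (p*q*(s-p)*(s-q))) / (s^2*(s^2-1))"
    by simp
  show ?thesis
    unfolding eq unfolding N s b0_def using nz by (simp add: assms(2) divide_simps)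
qed

text \<open>The same symmetry, now exchanging y + 1/12 with y - 13/12 and y - 7/12 with y - 5/12;
  the reversed pairs come from r = 8.\<close>

lemma b2_eq:
  assumes "y > 1" "s = 2*y - 1"
    and "p = y + 1/12 \<and> q = y - 7/12 \<or> p = y - 7/12 \<and> q = y + 1/12
       \<or> p = y - 13/12 \<and> q = y - 5/12 \<or> p = y - 5/12 \<and> q = y - 13/12"
  shows "b2 y = 1728^2 * (p*q*(s-p)*(s-q)/(s^2*(s^2-1)))"
proof -
  have s: "s^2 - 1 = 4 * y * (y - 1)" by (simp add: assms(2) power2_eq_square algebra_simps)
  have nz: "2*y - 1 \<noteq> 0" "y - 1 \<noteq> 0" "y \<noteq> 0" using assms(1) by auto
  have "20736 * (p*q*(s-p)*(s-q)) = (12*p) * (12*q) * (12*(s-p)) * (12*(s-q))" by (simp add: algebra_simps)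
  also have "\<dots> = (12*y - 13) * (12*y - 7) * (12*y - 5) * (12*y + 1)"
    using assms(3) unfolding assms(2) by (elim disjE conjE; hypsubst) (simp_all add: algebra_simps)
  finally have N: "20736 * (p*q*(s-p)*(s-q)) = (12*y - 13) * (12*y - 7) * (12*y - 5) * (12*y + 1)" .
  have eq: "1728^2 * (p*q*(s-p)*(s-q)/(s^2*(s^2-1)))
    = 144 * (20736 * (p*q*(s-p)*(s-q))) / (s^2*(s^2-1))"
    by simp
  show ?thesis
    unfolding eq unfolding N s b2_def using nz by (simp add: assms(2) divide_simps)
qed

section \<open>Identifying the recursive sequences\<close>

lemma rec_from_1_eqI:
  assumes "f 0 = w0" "f (Suc 0) = w1"
    and "\<And>n. f (Suc (Suc n)) = [:- coeff_a (Suc n) r, 1:] * f (Suc n) - smult (coeff_b (Suc n) r) (f n)"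
  shows "rec_from_1 r w0 w1 n = f n"
  by (induction n rule: induct_nat_012) (simp_all only: rec_from_1.simps assms)

lemma rec_from_2_eqI:
  assumes "f (Suc 0) = w1" "f (Suc (Suc 0)) = w2" "n \<ge> 1"
    and "\<And>n. f (Suc (Suc (Suc n))) = [:- coeff_a (Suc (Suc n)) r, 1:] * f (Suc (Suc n))
      - smult (coeff_b (Suc (Suc n)) r) (f (Suc n))"
  shows "rec_from_2 r w0 w1 w2 n = f n"
proof -
  \<comment> \<open>The recursion is anchored at indices 1 and 2, so the induction runs over
    \<open>Suc m\<close>.\<close>
  have "rec_from_2 r w0 w1 w2 (Suc m) = f (Suc m)" for m
    by (induction m rule: induct_nat_012) (simp_all only: rec_from_2.simps assms(1,2,4))
  then show ?thesis using assms(3) by (cases n) simp_all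
qed


text \<open>Here d = n and S = 2d, which both vanishing results allow; the choice of \<beta> selects
  between them, and \<open>\<beta> < 1\<close> keeps \<beta> different from d \<ge> 1.\<close>

lemma rec_from_1_eq_hyp_poly:
  assumes "r = 6 \<and> (c1 = 1/12 \<and> c2 = 5/12 \<or> c1 = -1/12 \<and> c2 = -5/12)
      \<or> r = 8 \<and> (c1 = 1/12 \<and> c2 = -7/12 \<or> c1 = -1/12 \<and> c2 = 7/12)"
    and \<alpha>: "\<alpha> = - c1" and \<beta>: "\<beta> = - c2 \<or> \<beta> = - 1 - c2" "\<beta> < 1"
    and w1: "w1 = [:1728 * (\<alpha> * \<beta> - (1 + c1) * (1 + c2) / 2), 1:]"
  shows "rec_from_1 r 1 w1 n = hyp_poly \<alpha> \<beta> n (of_nat n + c1) (of_nat n + c2) (2 * of_nat n)"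
proof (rule rec_from_1_eqI)
  fix n :: nat
  define x :: rat where "x = of_nat (Suc n)"
  have x: "x \<ge> 1" by (simp add: x_def)
  let ?p = "x + c1" and ?q = "x + c2" and ?s = "2 * x"
  have a: "coeff_a (Suc n) r = 1728 * ((?p+1)*(?q+1)/(?s+2) - ?p*?q/?s)"
    using assms(1) x unfolding coeff_a_def x_def[symmetric]
    using a0_eq[of "x + 1/2" ?s ?p ?q] a2_eq[of "x + 1/2" ?s ?p ?q]
    by (elim disjE conjE; hypsubst) simp_all
  have b: "coeff_b (Suc n) r = 1728^2 * (?p*?q*(?s-?p)*(?s-?q)/(?s^2*(?s^2-1)))"
    using assms(1) x unfolding coeff_b_def x_def[symmetric]
    using b0_eq[of "x + 1/2" ?s ?p ?q] b2_eq[of "x + 1/2" ?s ?p ?q]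
    by (elim disjE conjE; hypsubst) simp_all
  show "hyp_poly \<alpha> \<beta> (Suc (Suc n)) (of_nat (Suc (Suc n)) + c1) (of_nat (Suc (Suc n)) + c2) (2 * of_nat (Suc (Suc n)))
    = [:- coeff_a (Suc n) r, 1:] * hyp_poly \<alpha> \<beta> (Suc n) (of_nat (Suc n) + c1) (of_nat (Suc n) + c2) (2 * of_nat (Suc n))
     - smult (coeff_b (Suc n) r) (hyp_poly \<alpha> \<beta> n (of_nat n + c1) (of_nat n + c2) (2 * of_nat n))"
    unfolding x_def[symmetric]
    by (rule hyp_poly_three_term[OF _ _ _ _ _ a b, where S = "2 * Suc n"])
       (use \<alpha> \<beta> x in \<open>auto simp: x_def\<close>)
qed (simp_all add: hyp_poly_0 hyp_poly_1 w1)

text \<open>The number \<open>e\<close> is n - d. With S = 2n - 1, \<open>e = 1\<close> gives the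
  unshifted vanishing result (S = 2d + 1) and \<open>e = 0\<close> the shifted one (S = 2d -
  1).\<close>

lemma rec_from_2_eq_hyp_poly:
  assumes r: "r = 0 \<and> (c1 = -11/12 \<and> c2 = -7/12 \<or> c1 = -1/12 \<and> c2 = -5/12)
      \<or> r = 2 \<and> (c1 = 1/12 \<and> c2 = -7/12 \<or> c1 = -13/12 \<and> c2 = -5/12)"
    and e: "e \<le> 1" and \<alpha>: "\<alpha> = - of_nat e - c1" and \<beta>: "\<beta> = - 1 - c2" "\<beta> < 1"
    and w1: "w1 = hyp_poly \<alpha> \<beta> (1 - e) (1 + c1) (1 + c2) 1"
    and w2: "w2 = hyp_poly \<alpha> \<beta> (2 - e) (2 + c1) (2 + c2) 3"
    and "n \<ge> 1"
  shows "rec_from_2 r w0 w1 w2 n = hyp_poly \<alpha> \<beta> (n - e) (of_nat n + c1) (of_nat n + c2) (2 * of_nat n - 1)"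
proof (rule rec_from_2_eqI)
  fix n :: nat
  define x :: rat where "x = of_nat (Suc (Suc n))"
  have x: "x \<ge> 2" by (simp add: x_def)
  let ?p = "x + c1" and ?q = "x + c2" and ?s = "2 * x - 1"
  have a: "coeff_a (Suc (Suc n)) r = 1728 * ((?p+1)*(?q+1)/(?s+2) - ?p*?q/?s)"
    using r x unfolding coeff_a_def x_def[symmetric]
    using a0_eq[of x ?s ?p ?q] a2_eq[of x ?s ?p ?q]
    by (elim disjE conjE; hypsubst) simp_all
  have b: "coeff_b (Suc (Suc n)) r = 1728^2 * (?p*?q*(?s-?p)*(?s-?q)/(?s^2*(?s^2-1)))"
    using r x unfolding coeff_b_def x_def[symmetric]
    using b0_eq[of x ?s ?p ?q] b2_eq[of x ?s ?p ?q]
    by (elim disjE conjE; hypsubst) simp_all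
  have e': "e = 0 \<or> e = 1" using e by auto
  show "hyp_poly \<alpha> \<beta> (Suc (Suc (Suc n)) - e) (of_nat (Suc (Suc (Suc n))) + c1)
        (of_nat (Suc (Suc (Suc n))) + c2) (2 * of_nat (Suc (Suc (Suc n))) - 1)
    = [:- coeff_a (Suc (Suc n)) r, 1:] * hyp_poly \<alpha> \<beta> (Suc (Suc n) - e) (of_nat (Suc (Suc n)) + c1)
        (of_nat (Suc (Suc n)) + c2) (2 * of_nat (Suc (Suc n)) - 1)
     - smult (coeff_b (Suc (Suc n)) r) (hyp_poly \<alpha> \<beta> (Suc n - e) (of_nat (Suc n) + c1)
        (of_nat (Suc n) + c2) (2 * of_nat (Suc n) - 1))"
    unfolding x_def[symmetric]
    \<comment> \<open>The current index is n + 2, hence S = 2 (n + 2) - 1.\<close>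
    by (rule hyp_poly_three_term[OF _ _ _ _ _ a b, where S = "2 * n + 3"])
       (use e' \<alpha> \<beta> x in \<open>auto simp: x_def\<close>)
qed (use assms in \<open>simp_all add: numeral_2_eq_2\<close>)

section \<open>The eight families and the final formulas\<close>

lemma atkin_A_eq_hyp_poly:
  assumes "(r \<in> {0, 2} \<and> n \<ge> 1) \<or> r \<in> {6, 8}"
  shows "atkin_A n r = (case kappa_A n r of (p, q, s) \<Rightarrow> hyp_poly (-1/12) (-5/12) (deg_A n r) p q s)"
proof -
  consider "r = 0" "n \<ge> 1" | "r = 2" "n \<ge> 1" | "r = 6" | "r = 8" using assms by auto
  then show ?thesis
  proof cases
    case 1
    \<comment> \<open>Offsets are written as added negative numbers, to match
      \<open>of_nat n + c1\<close> and \<open>of_nat n + c2\<close>; likewise \<open>n - 0\<close>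
      below matches \<open>n - e\<close>.\<close>
    have "rec_from_2 0 0 1 [:-824, 1:] n = hyp_poly (-1/12) (-5/12) (n - 1) (of_nat n + -11/12) (of_nat n + -7/12) (2 * of_nat n - 1)"
      using 1 by (intro rec_from_2_eq_hyp_poly) (simp_all add: hyp_poly_0 hyp_poly_1)
    with 1 show ?thesis
      by (simp add: atkin_A_def kappa_A_def deg_A_def Let_def)
  next
    case 2
    have "rec_from_2 2 1 [:-720, 1:] [:269280, -1640, 1:] n = hyp_poly (-1/12) (-5/12) (n - 0) (of_nat n + 1/12) (of_nat n + -7/12) (2 * of_nat n - 1)"
      using 2 by (intro rec_from_2_eq_hyp_poly) (simp_all add: hyp_poly_1 hyp_poly_2 numeral_2_eq_2)
    with 2 show ?thesis
      by (simp add: atkin_A_def kappa_A_def deg_A_def Let_def)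
  next
    case 3
    have "rec_from_1 6 1 [:-1266, 1:] n = hyp_poly (-1/12) (-5/12) n (of_nat n + 1/12) (of_nat n + 5/12) (2 * of_nat n)"
      by (intro rec_from_1_eq_hyp_poly) simp_all
    with 3 show ?thesis
      by (simp add: atkin_A_def kappa_A_def deg_A_def Let_def)
  next
    case 4
    have "rec_from_1 8 1 [:-330, 1:] n = hyp_poly (-1/12) (-5/12) n (of_nat n + 1/12) (of_nat n + -7/12) (2 * of_nat n)"
      by (intro rec_from_1_eq_hyp_poly) simp_all
    with 4 show ?thesis
      by (simp add: atkin_A_def kappa_A_def deg_A_def Let_def)
  qed
qed

lemma atkin_B_eq_hyp_poly:
  assumes "(r \<in> {0, 2} \<and> n \<ge> 1) \<or> r \<in> {6, 8}"
  shows "atkin_B n r = (case kappa_B n r of (p, q, s) \<Rightarrow> hyp_poly (1/12) (-7/12) (deg_B n r) p q s)"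
proof -
  consider "r = 0" "n \<ge> 1" | "r = 2" "n \<ge> 1" | "r = 6" | "r = 8" using assms by auto
  then show ?thesis
  proof cases
    case 1
    have "rec_from_2 0 1 [:-1008, 1:] [:497952, -1832, 1:] n = hyp_poly (1/12) (-7/12) (n - 0) (of_nat n + -1/12) (of_nat n + -5/12) (2 * of_nat n - 1)"
      using 1 by (intro rec_from_2_eq_hyp_poly) (simp_all add: hyp_poly_1 hyp_poly_2 numeral_2_eq_2)
    with 1 show ?thesis
      by (simp add: atkin_B_def kappa_B_def deg_B_def Let_def)
  next
    case 2
    have "rec_from_2 2 0 1 [:-920, 1:] n = hyp_poly (1/12) (-7/12) (n - 1) (of_nat n + -13/12) (of_nat n + -5/12) (2 * of_nat n - 1)"
      using 2 by (intro rec_from_2_eq_hyp_poly) (simp_all add: hyp_poly_0 hyp_poly_1)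
    with 2 show ?thesis
      by (simp add: atkin_B_def kappa_B_def deg_B_def Let_def)
  next
    case 3
    have "rec_from_1 6 1 [:-546, 1:] n = hyp_poly (1/12) (-7/12) n (of_nat n + -1/12) (of_nat n + -5/12) (2 * of_nat n)"
      by (intro rec_from_1_eq_hyp_poly) simp_all
    with 3 show ?thesis
      by (simp add: atkin_B_def kappa_B_def deg_B_def Let_def)
  next
    case 4
    have "rec_from_1 8 1 [:-1338, 1:] n = hyp_poly (1/12) (-7/12) n (of_nat n + -1/12) (of_nat n + 7/12) (2 * of_nat n)"
      by (intro rec_from_1_eq_hyp_poly) simp_all
    with 4 show ?thesis
      by (simp add: atkin_B_def kappa_B_def deg_B_def Let_def)
  qed
qed

theorem theorem2p3:
  fixes n r :: nat
  assumes "(r \<in> {0, 2} \<and> n \<ge> 1) \<or> r \<in> {6, 8}"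
  shows "atkin_A n r = (\<Sum>i=0..deg_A n r. monom (12^(3*i) * phi_A i n r) (deg_A n r - i))
       \<and> atkin_B n r = (\<Sum>i=0..deg_B n r. monom (12^(3*i) * phi_B i n r) (deg_B n r - i))
       \<and> degree (atkin_A n r) = deg_A n r
       \<and> degree (atkin_B n r) = deg_B n r"
proof -
  obtain p q s where A: "kappa_A n r = (p, q, s)" by (metis prod_cases3)
  obtain p' q' s' where B: "kappa_B n r = (p', q', s')" by (metis prod_cases3)
  \<comment> \<open>Up to the order of factors, these sums are \<open>hyp_conv\<close>; the degrees
    follow because its value at 0 is 1.\<close>
  have "phi_A i n r = hyp_conv (-1/12) (-5/12) p q s i"
    "phi_B i n r = hyp_conv (1/12) (-7/12) p' q' s' i" for i
    by (simp_all add: phi_A_def phi_B_def A B hyp_conv_def hyp_coeff_def mult_ac)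
  then show ?thesis
    using atkin_A_eq_hyp_poly[OF assms] atkin_B_eq_hyp_poly[OF assms]
    by (simp add: A B degree_hyp_poly) (simp add: hyp_poly_def rev_poly_def)
qed

end
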